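(* Let $\nu>0$ and let $\tilde\omega_0\in B_0$, where $B_0$ is either $B_0(\mathbb{R})$ or $B_0(\mathbb{S})$. Assume $\|\tilde\omega_0\|_{B_0}<\nu/4$. Then there exists $\tilde\omega\in\mathcal{B}_0$ (the corresponding space, $\mathcal{B}_0(\mathbb{R})$ or $\mathcal{B}_0(\mathbb{S})$) which is a global mild solution of $\tilde\omega_t=\tilde\omega\,\mathcal{H}\tilde\omega-\nu\tilde\omega$, $\tilde\omega(\cdot,0)=\tilde\omega_0$, i.e. for all $t\ge 0$, $$\tilde\omega(\cdot,t)=e^{-\nu t}\tilde\omega_0+\int_0^t e^{-\nu(t-s)}\,\tilde\omega(\cdot,s)\,\mathcal{H}(\tilde\omega)(\cdot,s)\,ds .$$
   Context: $\mathbb{S}$ denotes the circle $[-\pi,\pi]$ with periodic identification. $\mathcal{H}$ is the Hilbert transform, with Fourier symbol $-\mathrm{i}\,\mathrm{sgn}(k)$ (on $\mathbb{S}$ it is $\mathcal{H}f(x)=\frac{1}{2\pi}\mathrm{PV}\int_{-\pi}^{\pi}f(x')\cot\frac{x-x'}{2}dx'$). $B_0(\mathbb{R})$ is the Wiener algebra of functions whose Fourier transform lies in $L^1$, with norm $\int_{\mathbb{R}}|\hat f(\xi)|d\xi$; $B_0(\mathbb{S})$ is the space of periodic functions with Fourier coefficients in $\ell^1$, with norm $\sum_{k\in\mathbb{Z}}|\hat f(k)|$. The space-time spaces have norms $\|f\|_{\mathcal{B}_0(\mathbb{R})}=\int_{\mathbb{R}}\sup_{t\in[0,\infty)}|\hat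 f(\xi,t)|\,d\xi$ and $\|f\|_{\mathcal{B}_0(\mathbb{S})}=\sum_{k\in\mathbb{Z}}\sup_{t\in[0,\infty)}|\hat f(k,t)|$, where hats denote the spatial Fourier transform/coefficients. *)

theory Defs
  imports "HOL-Analysis.Analysis"
begin

text \<open>Convention: a function f belongs to the Wiener algebra iff it is the (everywhere,
 absolutely convergent) inverse Fourier transform of an integrable / summable
 coefficient function, with inversion formula without constant:
 f x = integral of fhat(xi) e^{i xi x} d xi on the line, f x = sum_k fhat(k) e^{ikx} on the circle.
 The norm is then the L1 / l1 norm of fhat.\<close>

definition is_fourier_rep_R :: "(real \<Rightarrow> complex) \<Rightarrow> (real \<Rightarrow> complex) \<Rightarrow> bool" where
  "is_fourier_rep_R f g \<longleftrightarrow> integrable lborel g \<and>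
     (\<forall>x. f x = (\<integral>\<xi>. g \<xi> * exp (\<i> * complex_of_real (\<xi> * x)) \<partial>lborel))"

definition B0R :: "(real \<Rightarrow> complex) \<Rightarrow> bool" where
  "B0R f \<longleftrightarrow> (\<exists>g. is_fourier_rep_R f g)"

definition fourier_R :: "(real \<Rightarrow> complex) \<Rightarrow> real \<Rightarrow> complex" where
  "fourier_R f = (SOME g. is_fourier_rep_R f g)"

definition B0R_norm :: "(real \<Rightarrow> complex) \<Rightarrow> real" where
  "B0R_norm f = (\<integral>\<xi>. cmod (fourier_R f \<xi>) \<partial>lborel)"

definition hilbert_R :: "(real \<Rightarrow> complex) \<Rightarrow> real \<Rightarrow> complex" where
  "hilbert_R f x = (\<integral>\<xi>. (- \<i> * complex_of_real (sgn \<xi>)) * fourier_R f \<xi>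
                        * exp (\<i> * complex_of_real (\<xi> * x)) \<partial>lborel)"

definition calB0R :: "(real \<Rightarrow> real \<Rightarrow> complex) \<Rightarrow> bool" where
  "calB0R w \<longleftrightarrow> (\<exists>G :: real \<Rightarrow> real \<Rightarrow> complex.
      (\<forall>t\<ge>0. (\<lambda>\<xi>. G \<xi> t) \<in> borel_measurable lborel \<and>
              (\<forall>x. w x t = (\<integral>\<xi>. G \<xi> t * exp (\<i> * complex_of_real (\<xi> * x)) \<partial>lborel))) \<and>
      (\<integral>\<^sup>+\<xi>. (SUP t\<in>{0..}. ennreal (cmod (G \<xi> t))) \<partial>lborel) < \<infinity>)"

definition is_fourier_rep_S :: "(real \<Rightarrow> complex) \<Rightarrow> (int \<Rightarrow> complex) \<Rightarrow> bool" where
  "is_fourier_rep_S f c \<longleftrightarrow> (\<lambda>k. norm (c k)) summable_on UNIV \<and>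
     (\<forall>x. f x = infsum (\<lambda>k. c k * exp (\<i> * complex_of_real (of_int k * x))) UNIV)"

definition B0S :: "(real \<Rightarrow> complex) \<Rightarrow> bool" where
  "B0S f \<longleftrightarrow> (\<exists>c. is_fourier_rep_S f c)"

definition fourier_S :: "(real \<Rightarrow> complex) \<Rightarrow> int \<Rightarrow> complex" where
  "fourier_S f = (SOME c. is_fourier_rep_S f c)"

definition B0S_norm :: "(real \<Rightarrow> complex) \<Rightarrow> real" where
  "B0S_norm f = infsum (\<lambda>k. cmod (fourier_S f k)) UNIV"

definition hilbert_S :: "(real \<Rightarrow> complex) \<Rightarrow> real \<Rightarrow> complex" where
  "hilbert_S f x = infsum (\<lambda>k. (- \<i> * of_int (sgn k)) * fourier_S f k
                        * exp (\<i> * complex_of_real (of_int k * x))) UNIV"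

definition calB0S :: "(real \<Rightarrow> real \<Rightarrow> complex) \<Rightarrow> bool" where
  "calB0S w \<longleftrightarrow> (\<exists>C :: int \<Rightarrow> real \<Rightarrow> complex.
      (\<forall>t\<ge>0. \<forall>x. w x t = infsum (\<lambda>k. C k t * exp (\<i> * complex_of_real (of_int k * x))) UNIV) \<and>
      (\<integral>\<^sup>+k. (SUP t\<in>{0..}. ennreal (cmod (C k t))) \<partial>count_space UNIV) < \<infinity>)"

definition mild_solution ::
  "((real \<Rightarrow> complex) \<Rightarrow> real \<Rightarrow> complex) \<Rightarrow> real \<Rightarrow> (real \<Rightarrow> complex)
     \<Rightarrow> (real \<Rightarrow> real \<Rightarrow> complex) \<Rightarrow> bool" where
  "mild_solution H \<nu> w0 w \<longleftrightarrow> (\<forall>t\<ge>0. \<forall>x.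
     ((\<lambda>s. complex_of_real (exp (- \<nu> * (t - s))) * w x s * H (\<lambda>y. w y s) x)
        has_integral (w x t - complex_of_real (exp (- \<nu> * t)) * w0 x)) {0..t})"

end

theory Submission
  imports Defs "HOL-Probability.Levy"
begin

text \<open>
  Split \<open>\<omega> = m + u + v\<close> into its mean and its parts with positive and with negative frequencies.
  Then \<open>\<H> \<omega> = - \<i> (u - v)\<close>, so \<open>\<omega> \<H> \<omega> = - \<i> (u\<^sup>2 + m u) + \<i> (v\<^sup>2 + m v)\<close>. Products of functions with
  positive frequencies have positive frequencies, so the equation decouples: \<open>m = c exp (- \<nu> t)\<close>, and
  for each \<open>x\<close> the values of \<open>u\<close> and \<open>v\<close> solve scalar Riccati equations. The substitution
  \<open>u = exp (- \<nu> t) U\<close> gives \<open>U = A f / (1 - \<kappa> E f)\<close>, where \<open>f\<close> is the initial value, \<open>\<kappa> = - \<i>\<close> (for \<open>v\<close>,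
  \<open>\<kappa> = \<i>\<close>), and \<open>A\<close>, \<open>E\<close> depend on \<open>t\<close> alone with \<open>|A| \<le> 2\<close>, \<open>|E| \<le> 2 / \<nu>\<close>. As the norm of \<open>f\<close> is below
  \<open>\<nu> / 4\<close>, the geometric series in \<open>f\<close> converges in the Wiener algebra uniformly in \<open>t\<close>, which bounds
  the space-time norm.

  The Hilbert transform is defined through an arbitrary choice of Fourier coefficients, so one also
  needs that coefficients are unique; this follows from Levy's uniqueness theorem for
  characteristic functions, applied to positive and negative parts.
\<close>

section \<open>Frequency spaces and the inverse Fourier transform\<close>

text \<open>The line has \<open>M = lborel\<close>, the circle counting measure on the integers.\<close>

locale frequency_space = sigma_finite_measure M
  for M :: "'a::ab_group_add measure" +
  fixes freq :: "'a \<Rightarrow> real"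
  assumes space_UNIV [simp]: "space M = UNIV"
    and measurable_minus: "(\<lambda>(k, l). k - l) \<in> M \<Otimes>\<^sub>M M \<rightarrow>\<^sub>M M"
    and translation_invariant: "distr M M (\<lambda>k. k - l) = M"
    and measurable_freq [measurable]: "freq \<in> borel_measurable M"
    and freq_diff: "freq (k - l) = freq k - freq l"
    and freq_sets: "A \<in> sets M \<Longrightarrow> \<exists>B\<in>sets borel. A = freq -` B"
begin

definition wave :: "real \<Rightarrow> 'a \<Rightarrow> complex" where
  "wave x k = exp (\<i> * complex_of_real (freq k * x))"

definition synth :: "('a \<Rightarrow> complex) \<Rightarrow> real \<Rightarrow> complex" where
  "synth g x = (\<integral>k. g k * wave x k \<partial>M)"

lemma measurable_wave [measurable]: "wave x \<in> borel_measurable M"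
  unfolding wave_def by measurable

lemma norm_wave [simp]: "norm (wave x k) = 1"
  by (simp add: wave_def)

lemma wave_diff_mult: "wave x (k - l) * wave x l = wave x k"
  by (simp add: wave_def freq_diff flip: exp_add) (simp add: algebra_simps)

lemma wave_0 [simp]: "wave 0 k = 1"
  by (simp add: wave_def)

lemma cnj_wave: "cnj (wave x k) = wave (- x) k"
  by (simp add: wave_def exp_cnj)

lemma integrable_mult_wave:
  assumes "integrable M g"
  shows "integrable M (\<lambda>k. g k * wave x k)"
  by (rule Bochner_Integration.integrable_bound[OF assms])
     (use assms in \<open>auto simp: norm_mult\<close>)

lemma norm_synth_le: "norm (synth g x) \<le> (\<integral>k. norm (g k) \<partial>M)"
  using integral_norm_bound[of M "\<lambda>k. g k * wave x k"] by (simp add: synth_def norm_mult)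

subsection \<open>Uniqueness of Fourier coefficients\<close>

text \<open>Pushing a density forward along \<open>freq\<close> gives a law on the reals, which is
  where Levy's theorem lives; \<open>synth\<close> then becomes a characteristic function on the
  line and on the circle alike.\<close>

lemma probability_density_distr_freq:
  fixes p :: "'a \<Rightarrow> real"
  assumes int: "integrable M p" and nn: "\<And>k. 0 \<le> p k" and one: "(\<integral>k. p k \<partial>M) = 1"
  shows "real_distribution (distr (density M (\<lambda>k. ennreal (p k))) borel freq)"
    and "char (distr (density M (\<lambda>k. ennreal (p k))) borel freq) x = synth (\<lambda>k. p k) x"
proof -
  have [measurable]: "p \<in> borel_measurable M" using int by auto
  let ?D = "density M (\<lambda>k. ennreal (p k))"
  have "emeasure ?D (space ?D) = 1"
    using nn_integral_eq_integral[OF int] nn one sets.top[of M] by (simp add: emeasure_density)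
  then interpret D: prob_space ?D by (rule prob_spaceI)
  have m: "freq \<in> measurable ?D borel" by measurable
  interpret E: prob_space "distr ?D borel freq" by (rule D.prob_space_distr[OF m])
  show "real_distribution (distr ?D borel freq)" by standard simp
  have "char (distr ?D borel freq) x = (\<integral>k. iexp (x * freq k) \<partial>?D)"
    unfolding char_def by (rule integral_distr) (simp_all add: m)
  also have "\<dots> = (\<integral>k. p k *\<^sub>R iexp (x * freq k) \<partial>M)"
    by (rule integral_density) (use nn in auto)
  also have "\<dots> = synth (\<lambda>k. p k) x"
    by (simp add: synth_def wave_def scaleR_conv_of_real mult.commute)
  finally show "char (distr ?D borel freq) x = synth (\<lambda>k. p k) x" .
qed

text \<open>The push-forward loses nothing: by \<open>freq_sets\<close> every measurable set is a
  preimage under \<open>freq\<close>.\<close>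

lemma density_determined_by_distr_freq:
  fixes p q :: "'a \<Rightarrow> ennreal"
  assumes [measurable]: "p \<in> borel_measurable M" "q \<in> borel_measurable M"
    and eq: "distr (density M p) borel freq = distr (density M q) borel freq"
  shows "AE k in M. p k = q k"
proof (rule density_unique)
  show "density M p = density M q"
  proof (rule measure_eqI)
    fix A assume "A \<in> sets (density M p)"
    then obtain B where B: "B \<in> sets borel" "A = freq -` B" using freq_sets[of A] by auto
    have "emeasure (density M p) A = emeasure (distr (density M p) borel freq) B"
      using B by (subst emeasure_distr) auto
    also have "\<dots> = emeasure (density M q) A"
      unfolding eq using B by (subst emeasure_distr) auto
    finally show "emeasure (density M p) A = emeasure (density M q) A" .
  qed simp
qed auto

text \<open>The positive and negative parts have equal transforms, and evaluation at 0 shows that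
  they have equal mass \<open>m\<close>. Either \<open>m = 0\<close> and both vanish, or division by
  \<open>m\<close> gives two probability densities with the same characteristic function.\<close>

lemma synth_real_eq_0_imp_AE_0:
  fixes h :: "'a \<Rightarrow> real"
  assumes int: "integrable M h" and zero: "\<And>x. synth (\<lambda>k. h k) x = 0"
  shows "AE k in M. h k = 0"
proof -
  define p n where "p k = max 0 (h k)" and "n k = max 0 (- h k)" for k
  have pn: "h k = p k - n k" "0 \<le> p k" "0 \<le> n k" for k by (auto simp: p_def n_def)
  have ii: "integrable M p" "integrable M n"
    unfolding p_def n_def using int by auto
  have [measurable]: "p \<in> borel_measurable M" "n \<in> borel_measurable M" using ii by auto
  have eq: "synth (\<lambda>k. p k) x = synth (\<lambda>k. n k) x" for x
  proof -
    have "synth (\<lambda>k. h k) x = synth (\<lambda>k. p k) x - synth (\<lambda>k. n k) x"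
      unfolding synth_def using ii
      by (subst Bochner_Integration.integral_diff[symmetric])
         (auto intro!: integrable_mult_wave simp: pn(1) algebra_simps)
    then show ?thesis using zero by simp
  qed
  define m where "m = (\<integral>k. p k \<partial>M)"
  have m2: "m = (\<integral>k. n k \<partial>M)"
    using eq[of 0] by (simp add: synth_def m_def)
  show ?thesis
  proof (cases "m = 0")
    case True
    then have "AE k in M. p k = 0" "AE k in M. n k = 0"
      using integral_nonneg_eq_0_iff_AE[OF ii(1)] integral_nonneg_eq_0_iff_AE[OF ii(2)]
      by (simp_all add: pn flip: m_def m2)
    then show ?thesis by eventually_elim (simp add: pn)
  next
    case False
    moreover have "m \<ge> 0" unfolding m_def by (rule Bochner_Integration.integral_nonneg) (simp add: pn)
    ultimately have m: "m > 0" by simp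
    have P: "integrable M (\<lambda>k. p k / m)" "\<And>k. 0 \<le> p k / m" "(\<integral>k. p k / m \<partial>M) = 1"
      and N: "integrable M (\<lambda>k. n k / m)" "\<And>k. 0 \<le> n k / m" "(\<integral>k. n k / m \<partial>M) = 1"
      using ii pn m by (auto simp: m_def[symmetric] m2[symmetric])
    have sc: "synth (\<lambda>k. complex_of_real (r k / m)) x = synth (\<lambda>k. r k) x / m" for r :: "'a \<Rightarrow> real" and x
      by (simp add: synth_def)
    have "distr (density M (\<lambda>k. ennreal (p k / m))) borel freq
        = distr (density M (\<lambda>k. ennreal (n k / m))) borel freq"
      by (rule Levy_uniqueness[OF probability_density_distr_freq(1)[OF P] probability_density_distr_freq(1)[OF N]])
         (auto simp only: probability_density_distr_freq(2)[OF P] probability_density_distr_freq(2)[OF N] sc eq)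
    then have "AE k in M. ennreal (p k / m) = ennreal (n k / m)"
      by (intro density_determined_by_distr_freq) auto
    then show ?thesis
      by eventually_elim (use pn m in \<open>auto simp: divide_simps\<close>)
  qed
qed

text \<open>Conjugating the coefficients conjugates the transform and reflects \<open>x\<close>, so
  the transform of the real part vanishes too, and hence that of the imaginary part.\<close>

lemma synth_eq_0_imp_AE_0:
  assumes int: "integrable M h" and zero: "\<And>x. synth h x = 0"
  shows "AE k in M. h k = 0"
proof -
  have c: "synth (\<lambda>k. cnj (h k)) x = 0" for x
  proof -
    have "synth (\<lambda>k. cnj (h k)) x = (\<integral>k. cnj (h k * wave (- x) k) \<partial>M)"
      by (simp add: synth_def cnj_wave)
    also have "\<dots> = cnj (synth h (- x))" by (simp only: synth_def Bochner_Integration.integral_cnj)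
    finally show ?thesis by (simp add: zero)
  qed
  have ic: "integrable M (\<lambda>k. cnj (h k))" using int by simp
  have re: "synth (\<lambda>k. complex_of_real (Re (h k))) x = 0" for x
  proof -
    have "synth (\<lambda>k. complex_of_real (Re (h k))) x = (\<integral>k. (h k * wave x k + cnj (h k) * wave x k) / 2 \<partial>M)"
      by (simp add: synth_def complex_add_cnj flip: distrib_right)
    also have "\<dots> = (synth h x + synth (\<lambda>k. cnj (h k)) x) / 2"
      unfolding synth_def using integrable_mult_wave[OF int] integrable_mult_wave[OF ic] by simp
    finally show ?thesis using zero c by simp
  qed
  have im: "synth (\<lambda>k. complex_of_real (Im (h k))) x = 0" for x
  proof -
    have "synth h x = (\<integral>k. complex_of_real (Re (h k)) * wave x k + \<i> * (complex_of_real (Im (h k)) * wave x k) \<partial>M)"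
      unfolding synth_def
      by (intro Bochner_Integration.integral_cong) (simp_all add: complex_eq_iff algebra_simps)
    also have "\<dots> = synth (\<lambda>k. complex_of_real (Re (h k))) x + \<i> * synth (\<lambda>k. complex_of_real (Im (h k))) x"
      unfolding synth_def using int by (simp add: integrable_mult_wave)
    finally show ?thesis using zero re by simp
  qed
  have "AE k in M. Re (h k) = 0" "AE k in M. Im (h k) = 0"
    using int re im by (auto intro!: synth_real_eq_0_imp_AE_0)
  then show ?thesis by eventually_elim (simp add: complex_eq_iff)
qed

lemma synth_unique:
  assumes "integrable M g" "integrable M h" and "\<And>x. synth g x = synth h x"
  shows "AE k in M. g k = h k"
proof -
  have "synth (\<lambda>k. g k - h k) x = 0" for x
    using assms(3)[of x] integrable_mult_wave[OF assms(1), of x] integrable_mult_wave[OF assms(2), of x]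
    by (simp add: synth_def left_diff_distrib)
  then have "AE k in M. g k - h k = 0"
    using assms by (intro synth_eq_0_imp_AE_0) auto
  then show ?thesis by eventually_elim simp
qed

subsection \<open>Convolution powers\<close>

definition conv :: "('a \<Rightarrow> complex) \<Rightarrow> ('a \<Rightarrow> complex) \<Rightarrow> 'a \<Rightarrow> complex" where
  "conv g h k = (\<integral>l. g (k - l) * h l \<partial>M)"

lemma measurable_translation: "(\<lambda>k. k - l) \<in> M \<rightarrow>\<^sub>M M"
  using measurable_compose[OF measurable_Pair1' measurable_minus, of l]
    measurable_compose[OF measurable_Pair2' measurable_minus, of l] by simp

lemma integrable_translation:
  fixes g :: "'a \<Rightarrow> 'b::{banach, second_countable_topology}"
  assumes "integrable M g"
  shows "integrable M (\<lambda>k. g (k - l))"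
  using integrable_distr[OF measurable_translation, of l g]
  by (simp add: translation_invariant assms)

lemma integral_translation:
  fixes g :: "'a \<Rightarrow> 'b::{banach, second_countable_topology}"
  assumes "integrable M g"
  shows "(\<integral>k. g (k - l) \<partial>M) = (\<integral>k. g k \<partial>M)"
  using integral_distr[OF measurable_translation, of g l] assms
  by (simp add: translation_invariant)

text \<open>With \<open>l\<close> as outer variable the inner integral over \<open>k\<close> is
  evaluated by translation invariance. The value type is generic so that the result also covers the
  real functions \<open>norm (g k)\<close>.\<close>

lemma integrable_conv_kernel:
  fixes g h :: "'a \<Rightarrow> 'b::{banach, second_countable_topology, real_normed_field}"
  assumes g: "integrable M g" and h: "integrable M h"
  shows "integrable (M \<Otimes>\<^sub>M M) (\<lambda>(l, k). g (k - l) * h l)"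
proof -
  interpret pair_sigma_finite M M ..
  have [measurable]: "g \<in> borel_measurable M" "h \<in> borel_measurable M" using g h by auto
  have [measurable]: "(\<lambda>p. snd p - fst p) \<in> M \<Otimes>\<^sub>M M \<rightarrow>\<^sub>M M"
    using measurable_compose[OF measurable_pair_swap' measurable_minus] by (simp add: case_prod_beta)
  show ?thesis
  proof (rule Fubini_integrable)
    have "(\<integral>k. norm (g (k - l) * h l) \<partial>M) = (\<integral>k. norm (g k) \<partial>M) * norm (h l)" for l
      using integral_translation[of "\<lambda>k. norm (g k)" l] g by (simp add: norm_mult)
    then show "integrable M (\<lambda>l. \<integral>k. norm (case (l, k) of (l, k) \<Rightarrow> g (k - l) * h l) \<partial>M)"
      using h by simp
    show "AE l in M. integrable M (\<lambda>k. case (l, k) of (l, k) \<Rightarrow> g (k - l) * h l)"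
      using integrable_translation[OF g] by simp
  qed (simp add: case_prod_beta, measurable)
qed

lemma integrable_swapped_conv_kernel:
  fixes g h :: "'a \<Rightarrow> 'b::{banach, second_countable_topology, real_normed_field}"
  assumes g: "integrable M g" and h: "integrable M h"
  shows "integrable (M \<Otimes>\<^sub>M M) (\<lambda>(k, l). g (k - l) * h l)"
proof -
  interpret pair_sigma_finite M M ..
  show ?thesis using integrable_product_swap[OF integrable_conv_kernel[OF g h]] by simp
qed

lemma integral_conv_kernel:
  fixes g h :: "'a \<Rightarrow> 'b::{banach, second_countable_topology, real_normed_field}"
  assumes g: "integrable M g" and h: "integrable M h"
  shows "(\<integral>k. (\<integral>l. g (k - l) * h l \<partial>M) \<partial>M) = (\<integral>k. g k \<partial>M) * (\<integral>l. h l \<partial>M)"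
proof -
  interpret pair_sigma_finite M M ..
  have "(\<integral>k. (\<integral>l. g (k - l) * h l \<partial>M) \<partial>M) = (\<integral>l. (\<integral>k. g (k - l) * h l \<partial>M) \<partial>M)"
    using Fubini_integral[OF integrable_conv_kernel[OF g h]] by simp
  also have "\<dots> = (\<integral>k. g k \<partial>M) * (\<integral>l. h l \<partial>M)"
    using g h integral_translation[OF g] integrable_translation[OF g] by simp
  finally show ?thesis .
qed

lemma integrable_conv:
  assumes g: "integrable M g" and h: "integrable M h"
  shows "integrable M (conv g h)"
proof -
  interpret pair_sigma_finite M M ..
  show ?thesis
    using integrable_fst'[OF integrable_swapped_conv_kernel[OF g h]] by (simp add: conv_def[abs_def])
qed

text \<open>Young's inequality in L1, that is, submultiplicativity of the Wiener norm.\<close>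

lemma integral_norm_conv_le:
  assumes g: "integrable M g" and h: "integrable M h"
  shows "(\<integral>k. norm (conv g h k) \<partial>M) \<le> (\<integral>k. norm (g k) \<partial>M) * (\<integral>k. norm (h k) \<partial>M)"
proof -
  interpret pair_sigma_finite M M ..
  have ng: "integrable M (\<lambda>k. norm (g k))" and nh: "integrable M (\<lambda>k. norm (h k))" using g h by auto
  have "(\<integral>k. norm (conv g h k) \<partial>M) \<le> (\<integral>k. (\<integral>l. norm (g (k - l)) * norm (h l) \<partial>M) \<partial>M)"
  proof (rule integral_mono)
    show "integrable M (\<lambda>k. norm (conv g h k))" using integrable_conv[OF g h] by simp
    show "integrable M (\<lambda>k. \<integral>l. norm (g (k - l)) * norm (h l) \<partial>M)"
      using integrable_fst'[OF integrable_swapped_conv_kernel[OF ng nh]] by simp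
    show "norm (conv g h k) \<le> (\<integral>l. norm (g (k - l)) * norm (h l) \<partial>M)" for k
      using integral_norm_bound[of M "\<lambda>l. g (k - l) * h l"] by (simp add: conv_def norm_mult)
  qed
  also have "\<dots> = (\<integral>k. norm (g k) \<partial>M) * (\<integral>k. norm (h k) \<partial>M)"
    by (rule integral_conv_kernel[OF ng nh])
  finally show ?thesis .
qed

lemma synth_conv:
  assumes g: "integrable M g" and h: "integrable M h"
  shows "synth (conv g h) x = synth g x * synth h x"
proof -
  have "conv g h k * wave x k = (\<integral>l. (g (k - l) * wave x (k - l)) * (h l * wave x l) \<partial>M)" for k
  proof -
    have "(g (k - l) * wave x (k - l)) * (h l * wave x l) = g (k - l) * h l * wave x k" for l
      by (simp add: wave_diff_mult[of x k l, symmetric])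
    \<comment> \<open>Pulling out the constant factor is valid for non-integrable functions as well,
      so the identity holds for every \<open>k\<close> and not just almost everywhere.\<close>
    then show ?thesis by (simp only: conv_def integral_mult_left_zero)
  qed
  then show ?thesis
    unfolding synth_def
    using integral_conv_kernel[OF integrable_mult_wave[OF g] integrable_mult_wave[OF h]] by simp
qed

text \<open>The index is shifted: \<open>conv_power g n\<close> is the \<open>(n + 1)\<close>-fold convolution.\<close>

primrec conv_power :: "('a \<Rightarrow> complex) \<Rightarrow> nat \<Rightarrow> 'a \<Rightarrow> complex" where
  "conv_power g 0 = g"
| "conv_power g (Suc n) = conv g (conv_power g n)"

lemma integrable_conv_power: "integrable M g \<Longrightarrow> integrable M (conv_power g n)"
  by (induction n) (auto intro: integrable_conv)

lemma integral_norm_conv_power_le: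
  assumes "integrable M g"
  shows "(\<integral>k. norm (conv_power g n k) \<partial>M) \<le> (\<integral>k. norm (g k) \<partial>M) ^ Suc n"
proof (induction n)
  case (Suc n)
  have "(\<integral>k. norm (conv_power g (Suc n) k) \<partial>M)
      \<le> (\<integral>k. norm (g k) \<partial>M) * (\<integral>k. norm (conv_power g n k) \<partial>M)"
    using assms by (simp add: integral_norm_conv_le integrable_conv_power)
  also have "\<dots> \<le> (\<integral>k. norm (g k) \<partial>M) * (\<integral>k. norm (g k) \<partial>M) ^ Suc n"
    by (intro mult_left_mono Suc) simp
  finally show ?case by simp
qed simp

lemma synth_conv_power: "integrable M g \<Longrightarrow> synth (conv_power g n) x = synth g x ^ Suc n"
  by (induction n) (auto simp: synth_conv integrable_conv_power)

text \<open>If \<open>k\<close> is not strictly on the side chosen by \<open>\<sigma>\<close>, then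
  \<open>l\<close> or \<open>k - l\<close> is not either, so every integrand vanishes. The signs 1
  and -1 of \<open>\<sigma>\<close> give the positive and the negative frequencies.\<close>

lemma conv_power_support:
  fixes \<sigma> :: real
  assumes supp: "\<And>k. \<sigma> * freq k \<le> 0 \<Longrightarrow> g k = 0" and "\<sigma> * freq k \<le> 0"
  shows "conv_power g n k = 0"
  using assms(2)
proof (induction n arbitrary: k)
  case (Suc n)
  have "g (k - l) * conv_power g n l = 0" for l
  proof (cases "\<sigma> * freq l \<le> 0")
    case False
    then have "\<sigma> * freq (k - l) \<le> 0" using Suc.prems by (simp add: freq_diff algebra_simps)
    then show ?thesis by (simp add: supp)
  qed (simp add: Suc.IH)
  then have "conv g (conv_power g n) k = (\<integral>l. 0 \<partial>M)"
    unfolding conv_def by (simp only:)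
  then show ?case by simp
qed (simp add: supp)

end

subsection \<open>The Riccati equation\<close>

text \<open>Mean value inequality on a ball where the derivative is bounded by 2.\<close>

lemma norm_exp_minus_1_le:
  fixes z :: complex
  assumes "norm z \<le> 1/4"
  shows "norm (exp z - 1) \<le> 2 * norm z"
proof -
  have "norm (exp z - exp 0) \<le> 2 * norm (z - 0)"
  proof (rule field_differentiable_bound[of "cball 0 (1/4)"])
    show "(exp has_field_derivative exp w) (at w within cball 0 (1/4))" for w :: complex
      by (rule DERIV_subset[OF DERIV_exp]) simp
    show "norm (exp w) \<le> 2" if "w \<in> cball 0 (1/4)" for w :: complex
      using exp_bound_half[of w] that by simp
  qed (use assms in auto)
  then show ?thesis by simp
qed

text \<open>In the time variable \<open>\<tau> = (1 - exp (- \<nu> t)) / \<nu>\<close>, which stays below \<open>1 / \<nu>\<close>, the equation for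
  \<open>U = exp (\<nu> t) u\<close> reads \<open>dU/d\<tau> = \<kappa> c U + \<kappa> U\<^sup>2\<close>. Its linear part has the propagator \<open>A\<close>, and \<open>E\<close>
  is the primitive of \<open>A\<close> in \<open>\<tau>\<close>.\<close>

lemma riccati_coefficients:
  fixes \<kappa> c :: complex and \<nu> :: real
  assumes \<nu>: "\<nu> > 0" and \<kappa>: "norm \<kappa> = 1" and c: "norm c \<le> \<nu> / 4"
  obtains A E :: "real \<Rightarrow> complex" where
    "A 0 = 1" "E 0 = 0"
    "\<forall>t\<ge>0. norm (A t) \<le> 2" "\<forall>t\<ge>0. norm (E t) \<le> 2 / \<nu>"
    "\<forall>t S. (A has_vector_derivative exp (- \<nu> * t) * (\<kappa> * c * A t)) (at t within S)"
    "\<forall>t S. (E has_vector_derivative exp (- \<nu> * t) * A t) (at t within S)"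
proof -
  define \<tau> :: "real \<Rightarrow> real" where "\<tau> t = (1 - exp (- \<nu> * t)) / \<nu>" for t
  define A where "A t = exp (\<kappa> * c * complex_of_real (\<tau> t))" for t
  \<comment> \<open>The case \<open>c = 0\<close> is the limit of the quotient as \<open>c\<close>
    tends to 0.\<close>
  define E where "E t = (if c = 0 then complex_of_real (\<tau> t) else (A t - 1) / (\<kappa> * c))" for t
  have \<kappa>0: "\<kappa> \<noteq> 0" using \<kappa> by auto
  have \<tau>': "(\<tau> has_real_derivative exp (- \<nu> * t)) (at t within S)" for t S
    unfolding \<tau>_def using \<nu> by (auto intro!: derivative_eq_intros)
  then have \<tau>'': "((\<lambda>t. complex_of_real (\<tau> t)) has_vector_derivative complex_of_real (exp (- \<nu> * t))) (at t within S)" for t S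
    by (intro has_vector_derivative_of_real) (simp add: has_real_derivative_iff_has_vector_derivative)
  have A': "(A has_vector_derivative exp (- \<nu> * t) * (\<kappa> * c * A t)) (at t within S)" for t S
  proof -
    have "((\<lambda>z. exp (\<kappa> * c * z)) has_field_derivative \<kappa> * c * exp (\<kappa> * c * z)) (at z within T)" for z :: complex and T
      by (auto intro!: derivative_eq_intros)
    from field_vector_diff_chain_within[OF \<tau>''[of t S] this]
    show ?thesis unfolding A_def[abs_def] by (simp add: o_def mult_ac)
  qed
  have E': "(E has_vector_derivative exp (- \<nu> * t) * A t) (at t within S)" for t S
  proof (cases "c = 0")
    case True
    then show ?thesis using \<tau>''[of t S] by (simp add: E_def[abs_def] A_def)
  next
    case False
    have "((\<lambda>t. (A t - 1) / (\<kappa> * c)) has_vector_derivative (exp (- \<nu> * t) * (\<kappa> * c * A t) - 0) / (\<kappa> * c)) (at t within S)"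
      by (intro has_vector_derivative_divide has_vector_derivative_diff A' has_vector_derivative_const)
    then show ?thesis using False \<kappa>0 by (simp add: E_def[abs_def])
  qed
  have \<tau>b: "0 \<le> \<tau> t" "\<tau> t \<le> 1 / \<nu>" if "t \<ge> 0" for t
    using that \<nu> by (auto simp: \<tau>_def divide_simps)
  have z: "norm (\<kappa> * c * complex_of_real (\<tau> t)) = norm c * \<tau> t" "norm c * \<tau> t \<le> 1 / 4" if "t \<ge> 0" for t
  proof -
    show "norm (\<kappa> * c * complex_of_real (\<tau> t)) = norm c * \<tau> t"
      using \<tau>b[OF that] \<kappa> by (simp add: norm_mult)
    have "norm c * \<tau> t \<le> \<nu> / 4 * (1 / \<nu>)"
      using \<tau>b[OF that] c \<nu> by (intro mult_mono) auto
    then show "norm c * \<tau> t \<le> 1 / 4" using \<nu> by simp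
  qed
  have "norm (A t) \<le> 2" if "t \<ge> 0" for t
    using exp_bound_half[of "\<kappa> * c * complex_of_real (\<tau> t)"] z[OF that] by (simp add: A_def)
  moreover have "norm (E t) \<le> 2 / \<nu>" if t: "t \<ge> 0" for t
  proof (cases "c = 0")
    case True
    then show ?thesis using \<tau>b[OF t] \<nu> by (simp add: E_def divide_simps)
  next
    case False
    have "norm (E t) = norm (A t - 1) / norm c"
      using False \<kappa> by (simp add: E_def norm_divide norm_mult)
    also have "\<dots> \<le> 2 * (norm c * \<tau> t) / norm c"
      using norm_exp_minus_1_le[of "\<kappa> * c * complex_of_real (\<tau> t)"] z[OF t]
      by (intro divide_right_mono) (simp_all add: A_def)
    also have "\<dots> = 2 * \<tau> t" using False by simp
    also have "\<dots> \<le> 2 / \<nu>" using \<tau>b[OF t] by simp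
    finally show ?thesis .
  qed
  moreover have "A 0 = 1" "E 0 = 0" by (auto simp: A_def E_def \<tau>_def)
  ultimately show ?thesis using that[of A E] A' E' by simp
qed

text \<open>With \<open>U = A f / D\<close> and \<open>D = 1 - \<kappa> E f\<close>, the derivative
  of \<open>A\<close> yields the linear term, and that of \<open>1 / D\<close> is
  \<open>\<kappa> e A f / D\<^sup>2\<close>, which multiplied by \<open>A f\<close> is the quadratic
  term.\<close>

lemma riccati_solution:
  fixes A E :: "real \<Rightarrow> complex"
  assumes "(A has_vector_derivative e * (\<kappa> * c * A t)) (at t within S)"
    and "(E has_vector_derivative e * A t) (at t within S)"
    and nz: "1 - \<kappa> * E t * f \<noteq> 0"
  shows "((\<lambda>t. A t * f / (1 - \<kappa> * E t * f)) has_vector_derivative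
     e * (\<kappa> * c * (A t * f / (1 - \<kappa> * E t * f)) + \<kappa> * (A t * f / (1 - \<kappa> * E t * f))\<^sup>2)) (at t within S)"
proof -
  let ?D = "\<lambda>t. 1 - \<kappa> * E t * f"
  have D': "(?D has_vector_derivative - (\<kappa> * (e * A t) * f)) (at t within S)"
    by (auto intro!: derivative_eq_intros assms)
  have "((\<lambda>z. inverse z) has_field_derivative - (inverse (?D t) * inverse (?D t))) (at (?D t) within ?D ` S)"
    using DERIV_inverse'[OF DERIV_ident nz] by (simp add: power2_eq_square)
  from field_vector_diff_chain_within[OF D' this]
  have I': "((\<lambda>t. inverse (?D t)) has_vector_derivative \<kappa> * (e * A t) * f * (inverse (?D t))\<^sup>2) (at t within S)"
    by (simp add: o_def power2_eq_square)
  have "((\<lambda>t. (A t * f) * inverse (?D t)) has_vector_derivative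
      (A t * f) * (\<kappa> * (e * A t) * f * (inverse (?D t))\<^sup>2) + (e * (\<kappa> * c * A t) * f) * inverse (?D t)) (at t within S)"
    by (intro has_vector_derivative_mult I' has_vector_derivative_mult_left assms(1))
  then show ?thesis by (simp add: divide_inverse algebra_simps power2_eq_square)
qed

section \<open>Power series in the Wiener algebra and the one-sided flow\<close>

context frequency_space
begin

text \<open>By Young's inequality the integrals are dominated by a geometric series of ratio
  \<open>q\<close> times the norm of \<open>g\<close>; exchanging sum and integral then gives
  finiteness almost everywhere.\<close>

lemma conv_power_majorant:
  assumes g: "integrable M g" and q: "0 \<le> q" "q * (\<integral>k. norm (g k) \<partial>M) < 1"
  shows "summable (\<lambda>n. \<integral>k. q ^ n * norm (conv_power g n k) \<partial>M)"
    and "AE k in M. summable (\<lambda>n. q ^ n * norm (conv_power g n k))"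
    and "integrable M (\<lambda>k. \<Sum>n. q ^ n * norm (conv_power g n k))"
proof -
  let ?r = "\<integral>k. norm (g k) \<partial>M"
  let ?h = "\<lambda>n k. q ^ n * norm (conv_power g n k)"
  have int: "integrable M (?h n)" for n
    using integrable_conv_power[OF g] by simp
  note [measurable] = borel_measurable_integrable[OF integrable_conv_power[OF g]]
  have r0: "0 \<le> ?r" by simp
  show sm: "summable (\<lambda>n. \<integral>k. ?h n k \<partial>M)"
  proof (rule summable_comparison_test[OF exI])
    show "summable (\<lambda>n. ?r * (q * ?r) ^ n)"
      by (intro summable_mult summable_geometric) (use q r0 in simp)
    show "\<forall>n\<ge>0. norm (\<integral>k. ?h n k \<partial>M) \<le> ?r * (q * ?r) ^ n"
      using mult_left_mono[OF integral_norm_conv_power_le[OF g], of "q ^ n" for n] q(1)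
      by (auto simp: power_mult_distrib mult_ac)
  qed
  have "(\<integral>\<^sup>+k. (\<Sum>n. ennreal (?h n k)) \<partial>M) = (\<Sum>n. \<integral>\<^sup>+k. ennreal (?h n k) \<partial>M)"
    by (rule nn_integral_suminf) simp
  also have "\<dots> = (\<Sum>n. ennreal (\<integral>k. ?h n k \<partial>M))"
    using q(1) by (intro suminf_cong nn_integral_eq_integral int) auto
  also have "\<dots> = ennreal (\<Sum>n. \<integral>k. ?h n k \<partial>M)"
    using q(1) by (intro suminf_ennreal2 sm) simp
  finally have "(\<integral>\<^sup>+k. (\<Sum>n. ennreal (?h n k)) \<partial>M) \<noteq> \<infinity>" by simp
  then have "AE k in M. (\<Sum>n. ennreal (?h n k)) \<noteq> \<infinity>"
    by (intro nn_integral_PInf_AE) simp_all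
  then show ae: "AE k in M. summable (\<lambda>n. ?h n k)"
    by eventually_elim (use q(1) in \<open>auto intro!: summable_suminf_not_top\<close>)
  show "integrable M (\<lambda>k. \<Sum>n. ?h n k)"
    by (rule integrable_suminf) (use int ae sm q(1) in \<open>simp_all add: abs_mult\<close>)
qed

text \<open>The last bound is stated for each \<open>k\<close> at which the majorant converges. The
  exceptional null set then depends on \<open>g\<close> and \<open>q\<close> but not on
  \<open>a\<close>, so it can serve uncountably many times at once when \<open>a\<close> varies with
  time.\<close>

lemma synth_conv_power_series:
  assumes g: "integrable M g" and q: "0 \<le> q" "q * (\<integral>k. norm (g k) \<partial>M) < 1"
    and a: "\<And>n. norm (a n) \<le> K * q ^ n"
  shows "integrable M (\<lambda>k. \<Sum>n. a n * conv_power g n k)"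
    and "synth (\<lambda>k. \<Sum>n. a n * conv_power g n k) x = (\<Sum>n. a n * synth g x ^ Suc n)"
    and "summable (\<lambda>n. q ^ n * norm (conv_power g n k)) \<Longrightarrow>
      norm (\<Sum>n. a n * conv_power g n k) \<le> K * (\<Sum>n. q ^ n * norm (conv_power g n k))"
proof -
  note major = conv_power_majorant[OF g q]
  let ?h = "\<lambda>n k. a n * conv_power g n k"
  have le: "norm (?h n k) \<le> K * (q ^ n * norm (conv_power g n k))" for n k
    using mult_right_mono[OF a, of "norm (conv_power g n k)" n] by (simp add: norm_mult mult_ac)
  have int: "integrable M (?h n)" for n
    using integrable_conv_power[OF g] by simp
  have ae: "AE k in M. summable (\<lambda>n. norm (?h n k))"
    using major(2)
  proof eventually_elim
    case (elim k)
    show ?case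
      by (rule summable_comparison_test[OF exI summable_mult[OF elim, of K]]) (use le in simp)
  qed
  have sm: "summable (\<lambda>n. \<integral>k. norm (?h n k) \<partial>M)"
  proof (rule summable_comparison_test[OF exI summable_mult[OF major(1), of K]])
    have "(\<integral>k. norm (?h n k) \<partial>M) \<le> (\<integral>k. K * (q ^ n * norm (conv_power g n k)) \<partial>M)" for n
      using int[of n] integrable_conv_power[OF g, of n] le by (intro integral_mono) auto
    then show "\<forall>n\<ge>0. norm (\<integral>k. norm (?h n k) \<partial>M) \<le> K * (\<integral>k. q ^ n * norm (conv_power g n k) \<partial>M)"
      by simp
  qed
  show "integrable M (\<lambda>k. \<Sum>n. ?h n k)"
    by (rule integrable_suminf[OF int ae sm])
  show "norm (\<Sum>n. ?h n k) \<le> K * (\<Sum>n. q ^ n * norm (conv_power g n k))"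
    if sk: "summable (\<lambda>n. q ^ n * norm (conv_power g n k))"
    using norm_suminf_le[OF le summable_mult[OF sk]] suminf_mult[OF sk] by simp
  have "synth (\<lambda>k. \<Sum>n. ?h n k) x = (\<integral>k. (\<Sum>n. ?h n k * wave x k) \<partial>M)"
    unfolding synth_def
  proof (rule integral_cong_AE)
    show "AE k in M. (\<Sum>n. ?h n k) * wave x k = (\<Sum>n. ?h n k * wave x k)"
      using ae by eventually_elim (rule suminf_mult2[OF summable_norm_cancel])
  qed (use int in \<open>auto intro!: borel_measurable_suminf borel_measurable_times\<close>)
  also have "\<dots> = (\<Sum>n. \<integral>k. ?h n k * wave x k \<partial>M)"
    by (rule integral_suminf) (use integrable_mult_wave[OF int] ae sm in \<open>simp_all add: norm_mult\<close>)
  also have "\<dots> = (\<Sum>n. a n * synth g x ^ Suc n)"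
    using synth_conv_power[OF g, of _ x] by (simp add: synth_def mult.assoc)
  finally show "synth (\<lambda>k. \<Sum>n. ?h n k) x = (\<Sum>n. a n * synth g x ^ Suc n)" .
qed

text \<open>Expands \<open>A f / (1 - \<kappa> E f)\<close> into the series of
  \<open>A (\<kappa> E)^n f^(n+1)\<close> and reads the powers of \<open>f\<close> as convolution
  powers of \<open>h\<close>. The bound \<open>D\<close> is free of \<open>t\<close>, which is what
  the space-time norm requires.\<close>

lemma one_sided_riccati_flow:
  fixes \<nu> \<sigma> :: real and \<kappa> c :: complex
  assumes \<nu>: "\<nu> > 0" and \<kappa>: "norm \<kappa> = 1" and c: "norm c \<le> \<nu> / 4"
    and h: "integrable M h" "(\<integral>k. norm (h k) \<partial>M) < \<nu> / 4"
    and supp: "\<And>k. \<sigma> * freq k \<le> 0 \<Longrightarrow> h k = 0"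
  obtains P :: "'a \<Rightarrow> real \<Rightarrow> complex" and D :: "'a \<Rightarrow> real" where
    "\<forall>t\<ge>0. integrable M (\<lambda>k. P k t)"
    "\<forall>k t. \<sigma> * freq k \<le> 0 \<longrightarrow> P k t = 0"
    "integrable M D"
    "AE k in M. \<forall>t\<ge>0. norm (P k t) \<le> D k"
    "\<forall>x. synth (\<lambda>k. P k 0) x = synth h x"
    "\<forall>t\<ge>0. \<forall>x. ((\<lambda>t. synth (\<lambda>k. P k t) x) has_vector_derivative
       exp (- \<nu> * t) * (\<kappa> * c * synth (\<lambda>k. P k t) x + \<kappa> * (synth (\<lambda>k. P k t) x)\<^sup>2)) (at t within {0..})"
proof -
  obtain A E :: "real \<Rightarrow> complex" where A0: "A 0 = 1" and E0: "E 0 = 0"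
    and "\<forall>t\<ge>0. norm (A t) \<le> 2" "\<forall>t\<ge>0. norm (E t) \<le> 2 / \<nu>"
      "\<forall>t S. (A has_vector_derivative exp (- \<nu> * t) * (\<kappa> * c * A t)) (at t within S)"
      "\<forall>t S. (E has_vector_derivative exp (- \<nu> * t) * A t) (at t within S)"
    by (rule riccati_coefficients[OF \<nu> \<kappa> c])
  note Ab = this(3)[rule_format] and Eb = this(4)[rule_format]
    and A' = this(5)[rule_format] and E' = this(6)[rule_format]
  define a where "a t n = A t * (\<kappa> * E t) ^ n" for t n
  define P where "P k t = (\<Sum>n. a t n * conv_power h n k)" for k t
  \<comment> \<open>\<open>q\<close> bounds \<open>\<kappa> * E t\<close>. As the norm of
    \<open>h\<close> is below \<open>\<nu> / 4\<close>, their product is below 1/2.\<close>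
  define q where "q = 2 / \<nu>"
  have q: "0 \<le> q" "q * (\<integral>k. norm (h k) \<partial>M) < 1" using \<nu> h(2) by (auto simp: q_def field_simps)
  have ab: "norm (a t n) \<le> 2 * q ^ n" if "t \<ge> 0" for t n
    unfolding a_def norm_mult norm_power q_def
    using Ab[OF that] Eb[OF that] \<kappa> by (intro mult_mono power_mono) auto
  note series = synth_conv_power_series[OF h(1) q ab]
  have small: "norm (\<kappa> * E t * synth h x) < 1" if "t \<ge> 0" for t x
  proof -
    have "norm (\<kappa> * E t * synth h x) \<le> q * (\<integral>k. norm (h k) \<partial>M)"
      unfolding norm_mult \<kappa> q_def
      using \<nu> Eb[OF that] norm_synth_le[of h x] by (intro mult_mono) auto
    then show ?thesis using q by simp
  qed
  have closed: "synth (\<lambda>k. P k t) x = A t * synth h x / (1 - \<kappa> * E t * synth h x)" if "t \<ge> 0" for t x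
  proof -
    have "(\<lambda>n. A t * synth h x * (\<kappa> * E t * synth h x) ^ n) sums (A t * synth h x * (1 / (1 - \<kappa> * E t * synth h x)))"
      by (intro sums_mult geometric_sums small that)
    moreover have "a t n * synth h x ^ Suc n = A t * synth h x * (\<kappa> * E t * synth h x) ^ n" for n
      by (simp add: a_def power_mult_distrib)
    ultimately show ?thesis
      unfolding P_def series(2)[OF that] by (simp only: sums_iff times_divide_eq_right mult_1_right)
  qed
  show thesis
  proof (rule that[of P "\<lambda>k. 2 * (\<Sum>n. q ^ n * norm (conv_power h n k))"]; (intro allI impI)?)
    show "integrable M (\<lambda>k. P k t)" if "t \<ge> 0" for t
      unfolding P_def by (rule series(1)[OF that])
    show "P k t = 0" if "\<sigma> * freq k \<le> 0" for k t
      using conv_power_support[where \<sigma> = \<sigma>, OF supp that] by (simp add: P_def)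
    show "integrable M (\<lambda>k. 2 * (\<Sum>n. q ^ n * norm (conv_power h n k)))"
      using conv_power_majorant(3)[OF h(1) q] by simp
    show "AE k in M. \<forall>t\<ge>0. norm (P k t) \<le> 2 * (\<Sum>n. q ^ n * norm (conv_power h n k))"
      using conv_power_majorant(2)[OF h(1) q]
      by eventually_elim (auto simp: P_def intro: series(3))
    show "synth (\<lambda>k. P k 0) x = synth h x" for x
      by (simp add: closed A0 E0)
    show "((\<lambda>t. synth (\<lambda>k. P k t) x) has_vector_derivative
       exp (- \<nu> * t) * (\<kappa> * c * synth (\<lambda>k. P k t) x + \<kappa> * (synth (\<lambda>k. P k t) x)\<^sup>2)) (at t within {0..})"
      if t: "t \<ge> 0" for t x
    proof -
      have "1 - \<kappa> * E t * synth h x \<noteq> 0" using small[OF t, of x] by auto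
      from riccati_solution[OF A' E' this]
      show ?thesis unfolding closed[OF t]
        \<comment> \<open>The closed form is known for nonnegative times only, hence the derivative
          within \<open>{0..}\<close>.\<close>
        by (rule has_vector_derivative_transform[rotated 2]) (use t closed in auto)
    qed
  qed
qed

subsection \<open>The solution in Fourier variables\<close>

text \<open>Acts on coefficients, so that no choice of a Fourier representation enters before the
  final translation.\<close>

definition hilbert_coeff :: "('a \<Rightarrow> complex) \<Rightarrow> 'a \<Rightarrow> complex" where
  "hilbert_coeff g k = - \<i> * complex_of_real (sgn (freq k)) * g k"

theorem mild_solution_coefficients:
  fixes \<nu> :: real
  assumes \<nu>: "\<nu> > 0" and g: "integrable M g" "(\<integral>k. norm (g k) \<partial>M) < \<nu> / 4"
  obtains G :: "'a \<Rightarrow> real \<Rightarrow> complex" where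
    "\<forall>t\<ge>0. integrable M (\<lambda>k. G k t)"
    "(\<integral>\<^sup>+k. (SUP t\<in>{0..}. ennreal (cmod (G k t))) \<partial>M) < \<infinity>"
    "\<forall>t\<ge>0. \<forall>x. ((\<lambda>s. complex_of_real (exp (- \<nu> * (t - s))) * synth (\<lambda>k. G k s) x
        * synth (hilbert_coeff (\<lambda>k. G k s)) x)
      has_integral (synth (\<lambda>k. G k t) x - complex_of_real (exp (- \<nu> * t)) * synth g x)) {0..t}"
proof -
  note [measurable] = borel_measurable_integrable[OF g(1)]
  have part: "integrable M (\<lambda>k. if Q (freq k) then g k else 0)"
      "(\<integral>k. norm (if Q (freq k) then g k else 0) \<partial>M) < \<nu> / 4"
    if [measurable]: "Measurable.pred borel Q" for Q
  proof -
    show *: "integrable M (\<lambda>k. if Q (freq k) then g k else 0)"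
      by (rule Bochner_Integration.integrable_bound[OF g(1)]) auto
    have "(\<integral>k. norm (if Q (freq k) then g k else 0) \<partial>M) \<le> (\<integral>k. norm (g k) \<partial>M)"
      by (rule integral_mono) (use * g(1) in auto)
    then show "(\<integral>k. norm (if Q (freq k) then g k else 0) \<partial>M) < \<nu> / 4" using g(2) by simp
  qed
  define g0 gp gn where "g0 k = (if freq k = 0 then g k else 0)"
    and "gp k = (if freq k > 0 then g k else 0)" and "gn k = (if freq k < 0 then g k else 0)" for k
  have g0: "integrable M g0" "(\<integral>k. norm (g0 k) \<partial>M) < \<nu> / 4"
    and gp: "integrable M gp" "(\<integral>k. norm (gp k) \<partial>M) < \<nu> / 4"
    and gn: "integrable M gn" "(\<integral>k. norm (gn k) \<partial>M) < \<nu> / 4"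
    using part[of "\<lambda>\<xi>. \<xi> = 0"] part[of "\<lambda>\<xi>. \<xi> > 0"] part[of "\<lambda>\<xi>. \<xi> < 0"]
    by (simp_all add: g0_def[abs_def] gp_def[abs_def] gn_def[abs_def])
  \<comment> \<open>On the circle this is the mean; on the line the frequency 0 is a null set and
    \<open>c\<close> is 0.\<close>
  define c where "c = (\<integral>k. g0 k \<partial>M)"
  have synth_g0: "synth g0 x = c" for x
    unfolding synth_def c_def by (intro Bochner_Integration.integral_cong) (auto simp: g0_def wave_def)
  have c: "norm c \<le> \<nu> / 4"
    using integral_norm_bound[of M g0] g0(2) unfolding c_def by linarith
  have synth_g: "synth g x = c + synth gp x + synth gn x" for x
  proof -
    have "synth g x = (\<integral>k. g0 k * wave x k + gp k * wave x k + gn k * wave x k \<partial>M)"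
      unfolding synth_def
      by (intro Bochner_Integration.integral_cong) (auto simp: g0_def gp_def gn_def)
    also have "\<dots> = synth g0 x + synth gp x + synth gn x"
      unfolding synth_def by (simp add: integrable_mult_wave g0 gp gn)
    finally show ?thesis by (simp add: synth_g0)
  qed
  have unit: "norm (- \<i>) = 1" "norm \<i> = 1" by simp_all
  have supp: "1 * freq k \<le> 0 \<Longrightarrow> gp k = 0" "(-1) * freq k \<le> 0 \<Longrightarrow> gn k = 0" for k
    by (simp_all add: gp_def gn_def)
  \<comment> \<open>The Hilbert symbol is \<open>- \<i>\<close> on positive frequencies and
    \<open>\<i>\<close> on negative ones; this fixes \<open>\<kappa>\<close> for \<open>P\<close>
    here and for \<open>N\<close> below.\<close>
  obtain P DP where P: "\<forall>t\<ge>0. integrable M (\<lambda>k. P k t)" "\<forall>k t. 1 * freq k \<le> 0 \<longrightarrow> P k t = 0"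
      "integrable M DP" "AE k in M. \<forall>t\<ge>0. norm (P k t) \<le> DP k" "\<forall>x. synth (\<lambda>k. P k 0) x = synth gp x"
      "\<forall>t\<ge>0. \<forall>x. ((\<lambda>t. synth (\<lambda>k. P k t) x) has_vector_derivative
         exp (- \<nu> * t) * (- \<i> * c * synth (\<lambda>k. P k t) x + - \<i> * (synth (\<lambda>k. P k t) x)\<^sup>2)) (at t within {0..})"
    by (rule one_sided_riccati_flow[OF \<nu> unit(1) c gp supp(1)])
  obtain N DN where N: "\<forall>t\<ge>0. integrable M (\<lambda>k. N k t)" "\<forall>k t. (-1) * freq k \<le> 0 \<longrightarrow> N k t = 0"
      "integrable M DN" "AE k in M. \<forall>t\<ge>0. norm (N k t) \<le> DN k" "\<forall>x. synth (\<lambda>k. N k 0) x = synth gn x"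
      "\<forall>t\<ge>0. \<forall>x. ((\<lambda>t. synth (\<lambda>k. N k t) x) has_vector_derivative
         exp (- \<nu> * t) * (\<i> * c * synth (\<lambda>k. N k t) x + \<i> * (synth (\<lambda>k. N k t) x)\<^sup>2)) (at t within {0..})"
    by (rule one_sided_riccati_flow[OF \<nu> unit(2) c gn supp(2)])
  \<comment> \<open>Undoes the substitution by the decay factor; the mean has no further
    dynamics.\<close>
  define G where "G k t = complex_of_real (exp (- \<nu> * t)) * (g0 k + P k t + N k t)" for k t
  define U V where "U x t = synth (\<lambda>k. P k t) x" and "V x t = synth (\<lambda>k. N k t) x" for x t
  have int_G: "integrable M (\<lambda>k. G k t)" if "t \<ge> 0" for t
    using P(1) N(1) g0(1) that by (simp add: G_def)
  have synth_G: "synth (\<lambda>k. G k t) x = complex_of_real (exp (- \<nu> * t)) * (c + U x t + V x t)"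
    if "t \<ge> 0" for t x
  proof -
    have "synth (\<lambda>k. G k t) x = (\<integral>k. complex_of_real (exp (- \<nu> * t))
        * (g0 k * wave x k + P k t * wave x k + N k t * wave x k) \<partial>M)"
      by (simp only: synth_def G_def algebra_simps)
    also have "\<dots> = complex_of_real (exp (- \<nu> * t)) * (synth g0 x + U x t + V x t)"
      using P(1) N(1) that by (simp add: synth_def U_def V_def integrable_mult_wave g0)
    finally show ?thesis by (simp add: synth_g0)
  qed
  have hilbert_G: "synth (hilbert_coeff (\<lambda>k. G k t)) x = complex_of_real (exp (- \<nu> * t)) * (- \<i> * (U x t - V x t))"
    if "t \<ge> 0" for t x
  proof -
    \<comment> \<open>At each frequency at most one of \<open>g0\<close>, \<open>P\<close>,
      \<open>N\<close> is nonzero, and the sign function removes \<open>g0\<close>.\<close>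
    have "hilbert_coeff (\<lambda>k. G k t) k * wave x k
        = complex_of_real (exp (- \<nu> * t)) * (- \<i> * (P k t * wave x k - N k t * wave x k))" for k
      using P(2)[rule_format, of k t] N(2)[rule_format, of k t]
      by (cases "freq k" "0 :: real" rule: linorder_cases)
         (simp_all add: hilbert_coeff_def G_def g0_def)
    then have "synth (hilbert_coeff (\<lambda>k. G k t)) x
        = (\<integral>k. complex_of_real (exp (- \<nu> * t)) * (- \<i> * (P k t * wave x k - N k t * wave x k)) \<partial>M)"
      by (simp only: synth_def)
    also have "\<dots> = complex_of_real (exp (- \<nu> * t)) * (- \<i> * (U x t - V x t))"
      using P(1) N(1) that by (simp add: synth_def U_def V_def integrable_mult_wave)
    finally show ?thesis .
  qed
  show thesis
  proof (rule that[of G]; (intro allI impI)?)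
    show "integrable M (\<lambda>k. G k t)" if "t \<ge> 0" for t by (rule int_G[OF that])
    \<comment> \<open>The outer norm gives the majorant the shape found in
      \<open>integrable_iff_bounded\<close>. The later use of \<open>nn_integral_mono_AE\<close> is
      sound although a supremum over uncountably many times may fail to be measurable.\<close>
    have "AE k in M. (SUP t\<in>{0..}. ennreal (cmod (G k t))) \<le> ennreal (norm (norm (g0 k) + DP k + DN k))"
      using P(4) N(4)
    proof eventually_elim
      case (elim k)
      have "cmod (G k t) \<le> norm (norm (g0 k) + DP k + DN k)" if t: "t \<ge> 0" for t
      proof -
        have "cmod (G k t) \<le> 1 * norm (g0 k + P k t + N k t)"
          unfolding G_def norm_mult using \<nu> t by (intro mult_right_mono) auto
        also have "\<dots> \<le> norm (g0 k) + norm (P k t) + norm (N k t)"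
          using norm_triangle_ineq[of "g0 k + P k t" "N k t"] norm_triangle_ineq[of "g0 k" "P k t"] by simp
        also have "\<dots> \<le> norm (g0 k) + DP k + DN k" using elim t by (intro add_mono) auto
        finally show ?thesis by simp
      qed
      then show ?case by (intro SUP_least ennreal_leI) auto
    qed
    then have "(\<integral>\<^sup>+k. (SUP t\<in>{0..}. ennreal (cmod (G k t))) \<partial>M)
        \<le> (\<integral>\<^sup>+k. ennreal (norm (norm (g0 k) + DP k + DN k)) \<partial>M)"
      by (rule nn_integral_mono_AE)
    also have "\<dots> < \<infinity>"
    proof -
      have "integrable M (\<lambda>k. norm (g0 k) + DP k + DN k)" using P(3) N(3) g0(1) by simp
      then show ?thesis by (simp only: integrable_iff_bounded)
    qed
    finally show "(\<integral>\<^sup>+k. (SUP t\<in>{0..}. ennreal (cmod (G k t))) \<partial>M) < \<infinity>" .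
    fix t x :: real assume t: "t \<ge> 0"
    define e where "e = complex_of_real (exp (- \<nu> * t))"
    have "((\<lambda>s. complex_of_real (exp (- \<nu> * (t - s))) * synth (\<lambda>k. G k s) x * synth (hilbert_coeff (\<lambda>k. G k s)) x)
        has_integral (e * (c + U x t + V x t) - e * (c + U x 0 + V x 0))) {0..t}"
    \<comment> \<open>The Duhamel integrand is the derivative in \<open>s\<close> of
      \<open>e * (c + U x s + V x s)\<close>, where \<open>e\<close> is the decay factor at the
      fixed final time \<open>t\<close>.\<close>
    proof (rule fundamental_theorem_of_calculus[OF t])
      fix s assume s: "s \<in> {0..t}"
      let ?E = "complex_of_real (exp (- \<nu> * s))"
      have "((\<lambda>s. e * (c + U x s + V x s)) has_vector_derivative
          e * (0 + ?E * (- \<i> * c * U x s + - \<i> * (U x s)\<^sup>2) + ?E * (\<i> * c * V x s + \<i> * (V x s)\<^sup>2)))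
          (at s within {0..t})"
        unfolding U_def V_def
        by (intro has_vector_derivative_mult_right has_vector_derivative_add has_vector_derivative_const
            has_vector_derivative_within_subset[OF P(6)[rule_format]]
            has_vector_derivative_within_subset[OF N(6)[rule_format]]) (use s in auto)
      moreover have "complex_of_real (exp (- \<nu> * (t - s))) * ?E = e"
        by (simp add: e_def algebra_simps flip: of_real_mult exp_add)
      \<comment> \<open>The cross terms cancel in \<open>(c + U + V) * (U - V)\<close>, leaving the
        two separate Riccati right-hand sides.\<close>
      then have "e * (0 + ?E * (- \<i> * c * U x s + - \<i> * (U x s)\<^sup>2) + ?E * (\<i> * c * V x s + \<i> * (V x s)\<^sup>2))
          = complex_of_real (exp (- \<nu> * (t - s))) * synth (\<lambda>k. G k s) x * synth (hilbert_coeff (\<lambda>k. G k s)) x"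
        using s by (simp add: synth_G hilbert_G power2_eq_square) (simp add: algebra_simps)
      ultimately show "((\<lambda>s. e * (c + U x s + V x s)) has_vector_derivative
          complex_of_real (exp (- \<nu> * (t - s))) * synth (\<lambda>k. G k s) x * synth (hilbert_coeff (\<lambda>k. G k s)) x)
          (at s within {0..t})" by simp
    qed
    then show "((\<lambda>s. complex_of_real (exp (- \<nu> * (t - s))) * synth (\<lambda>k. G k s) x * synth (hilbert_coeff (\<lambda>k. G k s)) x)
        has_integral (synth (\<lambda>k. G k t) x - complex_of_real (exp (- \<nu> * t)) * synth g x)) {0..t}"
      using P(5) N(5) t by (simp add: synth_G synth_g U_def V_def e_def)
  qed
qed

text \<open>Makes the Hilbert transform independent of the coefficients chosen to represent a
  function.\<close>

lemma synth_hilbert_coeff_unique: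
  assumes "integrable M g" "integrable M h" "\<And>x. synth g x = synth h x"
  shows "synth (hilbert_coeff g) x = synth (hilbert_coeff h) x"
proof -
  have [measurable]: "g \<in> borel_measurable M" "h \<in> borel_measurable M" using assms by auto
  have "AE k in M. g k = h k" by (rule synth_unique[OF assms])
  then show ?thesis
    unfolding synth_def hilbert_coeff_def
    by (intro integral_cong_AE) auto
qed

end

subsection \<open>The line and the circle\<close>

interpretation line: frequency_space lborel "\<lambda>\<xi>::real. \<xi>"
proof
  show "distr lborel lborel (\<lambda>k. k - l) = lborel" for l :: real
  proof -
    have "(\<lambda>k. k - l) = (+) (- l)" by auto
    then have "distr lborel lborel (\<lambda>k. k - l) = distr lborel borel ((+) (- l))"
      by (intro distr_cong) simp_all
    then show ?thesis by (simp only: lborel_distr_plus)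
  qed
  show "\<exists>B\<in>sets borel. A = (\<lambda>\<xi>. \<xi>) -` B" if "A \<in> sets lborel" for A :: "real set"
    using that by auto
qed simp_all

interpretation circle: frequency_space "count_space (UNIV :: int set)" real_of_int
proof -
  interpret sigma_finite_measure "count_space (UNIV :: int set)"
    by (rule sigma_finite_measure_count_space_countable) simp
  show "frequency_space (count_space (UNIV :: int set)) real_of_int"
  proof
    have "count_space (UNIV :: int set) \<Otimes>\<^sub>M count_space (UNIV :: int set) = count_space (UNIV \<times> UNIV)"
      by (rule pair_measure_countable) auto
    then show "(\<lambda>(k, l). k - l) \<in> count_space (UNIV :: int set) \<Otimes>\<^sub>M count_space UNIV \<rightarrow>\<^sub>M count_space UNIV"
      by simp
    show "distr (count_space UNIV) (count_space UNIV) (\<lambda>k. k - l) = count_space UNIV" for l :: int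
      by (rule distr_bij_count_space) (auto intro!: bij_betwI[where g = "\<lambda>k. k + l"])
    show "\<exists>B\<in>sets borel. A = real_of_int -` B" for A :: "int set"
    proof
      show "real_of_int ` A \<in> sets borel"
        by (rule sets.countable) auto
    qed auto
  qed simp_all
qed

lemma is_fourier_rep_R_iff:
  "is_fourier_rep_R f g \<longleftrightarrow> integrable lborel g \<and> (\<forall>x. f x = line.synth g x)"
  by (simp add: is_fourier_rep_R_def line.synth_def line.wave_def)

text \<open>\<open>infsetsum\<close> is by definition an integral over counting measure and links
  the two notions of sum.\<close>

lemma infsum_eq_circle_synth:
  assumes "integrable (count_space UNIV) c"
  shows "infsum (\<lambda>k. c k * exp (\<i> * complex_of_real (of_int k * x))) UNIV = circle.synth c x"
  using infsetsum_infsum[of "\<lambda>k. c k * circle.wave x k" UNIV] circle.integrable_mult_wave[OF assms, of x]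
  by (simp add: abs_summable_on_def infsetsum_def circle.synth_def circle.wave_def)

lemma is_fourier_rep_S_iff:
  "is_fourier_rep_S f c \<longleftrightarrow> integrable (count_space UNIV) c \<and> (\<forall>x. f x = circle.synth c x)"
  using abs_summable_equivalent[of c UNIV] infsum_eq_circle_synth[of c]
  by (auto simp: is_fourier_rep_S_def abs_summable_on_def)

lemma fourier_R_rep: "B0R f \<Longrightarrow> is_fourier_rep_R f (fourier_R f)"
  unfolding B0R_def fourier_R_def by (erule someI_ex)

lemma fourier_S_rep: "B0S f \<Longrightarrow> is_fourier_rep_S f (fourier_S f)"
  unfolding B0S_def fourier_S_def by (erule someI_ex)

text \<open>The coefficients picked by \<open>fourier_R\<close> may differ from \<open>g\<close> on
  a null set, which the integral does not see.\<close>

lemma hilbert_R_synth: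
  assumes "integrable lborel g"
  shows "hilbert_R (line.synth g) x = line.synth (line.hilbert_coeff g) x"
proof -
  let ?h = "fourier_R (line.synth g)"
  have "is_fourier_rep_R (line.synth g) ?h"
    using assms by (intro fourier_R_rep) (auto simp: B0R_def is_fourier_rep_R_iff)
  then have "line.synth (line.hilbert_coeff ?h) x = line.synth (line.hilbert_coeff g) x"
    using assms by (intro line.synth_hilbert_coeff_unique) (auto simp: is_fourier_rep_R_iff)
  then show ?thesis
    by (simp add: hilbert_R_def line.synth_def line.hilbert_coeff_def line.wave_def)
qed

lemma hilbert_S_synth:
  assumes "integrable (count_space UNIV) g"
  shows "hilbert_S (circle.synth g) x = circle.synth (circle.hilbert_coeff g) x"
proof -
  let ?h = "fourier_S (circle.synth g)"
  have rep: "is_fourier_rep_S (circle.synth g) ?h"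
    using assms by (intro fourier_S_rep) (auto simp: B0S_def is_fourier_rep_S_iff)
  then have int: "integrable (count_space UNIV) ?h" by (simp add: is_fourier_rep_S_iff)
  have sgn: "complex_of_real (sgn (real_of_int k)) = of_int (sgn k)" for k
    by (simp add: sgn_if)
  have "integrable (count_space UNIV) (circle.hilbert_coeff ?h)"
    by (rule Bochner_Integration.integrable_bound[OF int])
       (auto simp: circle.hilbert_coeff_def norm_mult sgn_if)
  then have "hilbert_S (circle.synth g) x = circle.synth (circle.hilbert_coeff ?h) x"
    using infsum_eq_circle_synth[of "circle.hilbert_coeff ?h" x] sgn
    by (simp add: hilbert_S_def circle.hilbert_coeff_def)
  also have "\<dots> = circle.synth (circle.hilbert_coeff g) x"
    using assms rep by (intro circle.synth_hilbert_coeff_unique) (auto simp: is_fourier_rep_S_iff)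
  finally show ?thesis .
qed

theorem theorem2p1:
  fixes \<nu> :: real
  assumes "\<nu> > 0"
  shows "(\<forall>w0. B0R w0 \<and> B0R_norm w0 < \<nu> / 4 \<longrightarrow>
            (\<exists>w. calB0R w \<and> mild_solution hilbert_R \<nu> w0 w))
       \<and> (\<forall>w0. B0S w0 \<and> B0S_norm w0 < \<nu> / 4 \<longrightarrow>
            (\<exists>w. calB0S w \<and> mild_solution hilbert_S \<nu> w0 w))"
proof (intro conjI allI impI; elim conjE)
  fix w0 assume w0: "B0R w0" "B0R_norm w0 < \<nu> / 4"
  define g where "g = fourier_R w0"
  have g: "integrable lborel g" "\<And>x. w0 x = line.synth g x"
    using fourier_R_rep[OF w0(1)] by (auto simp: is_fourier_rep_R_iff g_def)
  have "(\<integral>\<xi>. norm (g \<xi>) \<partial>lborel) < \<nu> / 4" using w0(2) by (simp add: B0R_norm_def g_def)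
  then obtain G where int: "\<forall>t\<ge>0. integrable lborel (\<lambda>\<xi>. G \<xi> t)"
    and sup: "(\<integral>\<^sup>+\<xi>. (SUP t\<in>{0..}. ennreal (cmod (G \<xi> t))) \<partial>lborel) < \<infinity>"
    and mild: "\<forall>t\<ge>0. \<forall>x. ((\<lambda>s. complex_of_real (exp (- \<nu> * (t - s))) * line.synth (\<lambda>\<xi>. G \<xi> s) x
        * line.synth (line.hilbert_coeff (\<lambda>\<xi>. G \<xi> s)) x)
      has_integral (line.synth (\<lambda>\<xi>. G \<xi> t) x - complex_of_real (exp (- \<nu> * t)) * line.synth g x)) {0..t}"
    by (rule line.mild_solution_coefficients[OF assms g(1)])
  define w where "w x t = line.synth (\<lambda>\<xi>. G \<xi> t) x" for x t
  have "calB0R w"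
    unfolding calB0R_def
  proof (intro exI[of _ G] conjI allI impI sup)
    show "(\<lambda>\<xi>. G \<xi> t) \<in> borel_measurable lborel" if "t \<ge> 0" for t
      using int that by (intro borel_measurable_integrable) simp
    show "w x t = (\<integral>\<xi>. G \<xi> t * exp (\<i> * complex_of_real (\<xi> * x)) \<partial>lborel)" for x t
      by (simp add: w_def line.synth_def line.wave_def)
  qed
  moreover have "mild_solution hilbert_R \<nu> w0 w"
    unfolding mild_solution_def
  proof (intro allI impI)
    fix t x :: real assume t: "t \<ge> 0"
    \<comment> \<open>Integrability of the coefficients is available for nonnegative times, so the
      integrand is rewritten on \<open>{0..t}\<close> only.\<close>
    have "hilbert_R (\<lambda>y. w y s) x = line.synth (line.hilbert_coeff (\<lambda>\<xi>. G \<xi> s)) x" if "s \<in> {0..t}" for s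
      unfolding w_def using int that by (intro hilbert_R_synth) auto
    then show "((\<lambda>s. complex_of_real (exp (- \<nu> * (t - s))) * w x s * hilbert_R (\<lambda>y. w y s) x)
        has_integral (w x t - complex_of_real (exp (- \<nu> * t)) * w0 x)) {0..t}"
      using mild[rule_format, OF t, of x] unfolding g(2) w_def
      by (rule_tac has_integral_eq) auto
  qed
  ultimately show "\<exists>w. calB0R w \<and> mild_solution hilbert_R \<nu> w0 w" by blast
next
  fix w0 assume w0: "B0S w0" "B0S_norm w0 < \<nu> / 4"
  define g where "g = fourier_S w0"
  have g: "integrable (count_space UNIV) g" "\<And>x. w0 x = circle.synth g x"
    using fourier_S_rep[OF w0(1)] by (auto simp: is_fourier_rep_S_iff g_def)
  \<comment> \<open>The smallness assumption is an unordered sum and must become an integral over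
    counting measure.\<close>
  have "infsum (\<lambda>k. cmod (g k)) UNIV = (\<integral>k. norm (g k) \<partial>count_space UNIV)"
    using infsetsum_infsum[of "\<lambda>k. cmod (g k)" UNIV] g(1) by (simp add: abs_summable_on_def infsetsum_def)
  then have "(\<integral>k. norm (g k) \<partial>count_space UNIV) < \<nu> / 4" using w0(2) by (simp add: B0S_norm_def g_def)
  then obtain G where int: "\<forall>t\<ge>0. integrable (count_space UNIV) (\<lambda>k. G k t)"
    and sup: "(\<integral>\<^sup>+k. (SUP t\<in>{0..}. ennreal (cmod (G k t))) \<partial>count_space UNIV) < \<infinity>"
    and mild: "\<forall>t\<ge>0. \<forall>x. ((\<lambda>s. complex_of_real (exp (- \<nu> * (t - s))) * circle.synth (\<lambda>k. G k s) x
        * circle.synth (circle.hilbert_coeff (\<lambda>k. G k s)) x)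
      has_integral (circle.synth (\<lambda>k. G k t) x - complex_of_real (exp (- \<nu> * t)) * circle.synth g x)) {0..t}"
    by (rule circle.mild_solution_coefficients[OF assms g(1)])
  define w where "w x t = circle.synth (\<lambda>k. G k t) x" for x t
  have "calB0S w"
    unfolding calB0S_def
  proof (intro exI[of _ G] conjI allI impI sup)
    show "w x t = infsum (\<lambda>k. G k t * exp (\<i> * complex_of_real (of_int k * x))) UNIV" if "t \<ge> 0" for x t
      using infsum_eq_circle_synth[of "\<lambda>k. G k t" x] int that by (simp add: w_def)
  qed
  moreover have "mild_solution hilbert_S \<nu> w0 w"
    unfolding mild_solution_def
  proof (intro allI impI)
    fix t x :: real assume t: "t \<ge> 0"
    have "hilbert_S (\<lambda>y. w y s) x = circle.synth (circle.hilbert_coeff (\<lambda>k. G k s)) x" if "s \<in> {0..t}" for s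
      unfolding w_def using int that by (intro hilbert_S_synth) auto
    then show "((\<lambda>s. complex_of_real (exp (- \<nu> * (t - s))) * w x s * hilbert_S (\<lambda>y. w y s) x)
        has_integral (w x t - complex_of_real (exp (- \<nu> * t)) * w0 x)) {0..t}"
      using mild[rule_format, OF t, of x] unfolding g(2) w_def
      by (rule_tac has_integral_eq) auto
  qed
  ultimately show "\<exists>w. calB0S w \<and> mild_solution hilbert_S \<nu> w0 w" by blast
qed

end
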